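(* Let $M>0$ and let $f=h+\overline{g}\in\mathcal{P}^0_{\mathcal{H}}(M)$ be given by $f(z)=z+\sum_{n=2}^{\infty}a_nz^n+\overline{\sum_{n=2}^{\infty}b_nz^n}$. Then $$r+\sum_{n=2}^{\infty}\Bigl(|a_n|+|b_n|+n(n-1)(|a_n|+|b_n|)^2\Bigr)r^n\le d\left(f(0),\partial f(\mathbb{D})\right)\qquad\text{for } r\le r_M,$$ where $r_M\in(0,1)$ is the smallest root of the equation $$r-1-2M(2M+1)\bigl(r+(1-r)\ln(1-r)\bigr)-2M(1-\ln 4)=0 .$$ The radius $r_M$ is the best possible.
   Context: $\mathbb{D}=\{z\in\mathbb{C}:|z|<1\}$. $\mathcal{H}_0$ is the class of complex-valued harmonic mappings $f=h+\overline{g}$ in $\mathbb{D}$ with $h,g$ analytic in $\mathbb{D}$, $h(0)=0$, $h'(0)=1$, $g(0)=0$, $g'(0)=0$. For $M>0$, $$\mathcal{P}^0_{\mathcal{H}}(M)=\{f=h+\overline{g}\in\mathcal{H}_0:\ \operatorname{Re}(zh''(z))>-M+|zg''(z)|\ \text{for all } z\in\mathbb{D}\}.$$ $d(f(0),\partial f(\mathbb{D}))$ denotes the Euclidean distance between $f(0)$ and the boundary of $f(\mathbb{D})$, given by $d(f(0),\partial f(\mathbb{D}))=\liminf_{|z|\to1}|f(z)-f(0)|$. "Best possible" means that the radius cannot be replaced by a larger one for the whole class.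
   Formalization: The sign before 2M(2M+1) in the equation for r_M is corrected from minus to plus (as printed there is no root for M=1, and the inequality fails whenever a root exists); r_M then exists exactly for M<1/(2(ln 4−1)), which is proved, and the claim holds whenever r_M exists. *)

theory Defs
  imports "HOL-Complex_Analysis.Complex_Analysis"
begin

definition H0_decomposition ::
  "(complex \<Rightarrow> complex) \<Rightarrow> (complex \<Rightarrow> complex) \<Rightarrow> (complex \<Rightarrow> complex) \<Rightarrow> bool" where
  "H0_decomposition f h g \<longleftrightarrow>
     h holomorphic_on ball 0 1 \<and> g holomorphic_on ball 0 1 \<and>
     (\<forall>z\<in>ball 0 1. f z = h z + cnj (g z)) \<and>
     h 0 = 0 \<and> deriv h 0 = 1 \<and> g 0 = 0 \<and> deriv g 0 = 0"

text \<open>The values of the members of this class outside the unit disc are irrelevant: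
  all notions below only look at the values in the disc.\<close>

definition PH0 :: "real \<Rightarrow> (complex \<Rightarrow> complex) set" where
  "PH0 M = {f. \<exists>h g. H0_decomposition f h g \<and>
     (\<forall>z\<in>ball 0 1. Re (z * deriv (deriv h) z) > - M + cmod (z * deriv (deriv g) z))}"

text \<open>\<open>f(z) = z + (\<Sum>n\<ge>2. a\<^sub>n z\<^sup>n) + cnj (\<Sum>n\<ge>2. b\<^sub>n z\<^sup>n)\<close>; the values of
  \<open>a\<close> and \<open>b\<close> at \<open>0\<close> and \<open>1\<close> play no role.\<close>

definition harmonic_expansion ::
  "(complex \<Rightarrow> complex) \<Rightarrow> (nat \<Rightarrow> complex) \<Rightarrow> (nat \<Rightarrow> complex) \<Rightarrow> bool" where
  "harmonic_expansion f a b \<longleftrightarrow>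
     (\<forall>z\<in>ball 0 1.
        summable (\<lambda>n. a (n + 2) * z ^ (n + 2)) \<and>
        summable (\<lambda>n. b (n + 2) * z ^ (n + 2)) \<and>
        f z = z + (\<Sum>n. a (n + 2) * z ^ (n + 2)) + cnj (\<Sum>n. b (n + 2) * z ^ (n + 2)))"

text \<open>The distance from \<open>f 0\<close> to the boundary of the image of the disc is taken to be
  the lower limit of \<open>|f z - f 0|\<close> as \<open>|z|\<close> tends to \<open>1\<close> from inside the disc.
  For non-univalent \<open>f\<close> this may differ from the distance to the topological frontier of the image.
  The extended reals are used because \<open>Liminf\<close> needs a complete lattice.\<close>

definition boundary_dist :: "(complex \<Rightarrow> complex) \<Rightarrow> ereal" where
  "boundary_dist f = Liminf (filtercomap cmod (at_left 1)) (\<lambda>z. ereal (cmod (f z - f 0)))"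

definition bohr_term :: "(nat \<Rightarrow> complex) \<Rightarrow> (nat \<Rightarrow> complex) \<Rightarrow> real \<Rightarrow> nat \<Rightarrow> real" where
  "bohr_term a b r n =
     (cmod (a n) + cmod (b n) + real n * (real n - 1) * (cmod (a n) + cmod (b n))\<^sup>2) * r ^ n"

text \<open>The sign of the middle term is forced by
  \<open>r + (\<Sum>n\<ge>2. (2M + 4M\<^sup>2) r\<^sup>n / (n (n - 1))) = 1 + 2M (1 - ln 4)\<close>, where
  \<open>(\<Sum>n\<ge>2. r\<^sup>n / (n (n - 1))) = r + (1 - r) ln (1 - r)\<close>: the left-hand side is the
  majorant for the extremal coefficients \<open>a\<^sub>n = 2M / (n (n - 1))\<close>, \<open>b\<^sub>n = 0\<close>, and the
  right-hand side is the sharp lower bound of the boundary distance. With a minus sign in front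
  of \<open>2M (2M + 1)\<close> there is no root for \<open>M = 1\<close>, and for large \<open>M\<close> there is a root
  but the Bohr inequality fails for every positive radius.\<close>

definition bohr_equation :: "real \<Rightarrow> real \<Rightarrow> bool" where
  "bohr_equation M r \<longleftrightarrow>
     r - 1 + 2 * M * (2 * M + 1) * (r + (1 - r) * ln (1 - r)) - 2 * M * (1 - ln 4) = 0"

definition smallest_bohr_root :: "real \<Rightarrow> real \<Rightarrow> bool" where
  "smallest_bohr_root M \<rho> \<longleftrightarrow>
     0 < \<rho> \<and> \<rho> < 1 \<and> bohr_equation M \<rho> \<and>
     (\<forall>s. 0 < s \<and> s < 1 \<and> bohr_equation M s \<longrightarrow> \<rho> \<le> s)"

end

theory Submission
  imports Defs "HOL-Real_Asymp.Real_Asymp"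
begin

text \<open>
  Everything reduces to the analytic functions \<open>F = h + \<epsilon> g\<close> with \<open>|\<epsilon>| = 1\<close>: the defining
  inequality of the class says that \<open>M + z F''\<close> has positive real part for every such \<open>\<epsilon>\<close>.
  Choosing \<open>\<epsilon>\<close> with \<open>|a\<^sub>n + \<epsilon> b\<^sub>n| = |a\<^sub>n| + |b\<^sub>n|\<close>, Caratheodory's coefficient inequality
  gives \<open>n (n - 1) (|a\<^sub>n| + |b\<^sub>n|) \<le> 2 M\<close>. For the distance, Harnack's inequality gives
  \<open>Re (w F'' (t w)) \<ge> - 2 M / (1 + t)\<close> on the radius through \<open>w\<close>, \<open>|w| = 1\<close>; integrating twice with
  \<open>\<epsilon> = w\<^sup>2\<close>, for which \<open>Re (cnj w F) = Re (cnj w f)\<close>, bounds \<open>|f|\<close> from below. Both estimates are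
  attained by \<open>f z = z - 2 M ((1 + z) Ln (1 + z) - z)\<close>, hence the sharpness.
\<close>

section \<open>Power series of the logarithmic functions\<close>

text \<open>Multiplying the series of \<open>Ln (1 + z)\<close> by \<open>1 + z\<close> adds
  neighbouring coefficients, and \<open>1 / (n + 1) - 1 / (n + 2)\<close> collapses to a single
  fraction. Subtracting \<open>z\<close> removes the only term below degree
  \<open>2\<close>.\<close>

lemma sums_one_plus_times_Ln:
  fixes z :: complex
  assumes "norm z < 1"
  shows "(\<lambda>n. (-1) ^ n / (of_nat (n + 2) * of_nat (n + 1)) * z ^ (n + 2)) sums ((1 + z) * Ln (1 + z) - z)"
proof -
  define c :: "nat \<Rightarrow> complex" where "c n = (-1) ^ Suc n / of_nat n" for n
  have s: "(\<lambda>n. c n * z ^ n) sums Ln (1 + z)"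
    unfolding c_def by (rule Ln_series[OF assms])
  have c01: "c 0 = 0" "c 1 = 1"
    by (simp_all add: c_def)
  have s1: "(\<lambda>n. c (n + 1) * z ^ (n + 1)) sums Ln (1 + z)"
    using sums_split_initial_segment[OF s, of 1] c01 by simp
  have s2: "(\<lambda>n. c (n + 2) * z ^ (n + 2)) sums (Ln (1 + z) - z)"
    using sums_split_initial_segment[OF s, of 2] c01 by (simp add: eval_nat_numeral)
  have "(\<lambda>n. c (n + 2) * z ^ (n + 2) + z * (c (n + 1) * z ^ (n + 1))) sums (Ln (1 + z) - z + z * Ln (1 + z))"
    by (intro sums_add s2 sums_mult s1)
  moreover have "c (n + 2) * z ^ (n + 2) + z * (c (n + 1) * z ^ (n + 1))
      = (-1) ^ n / (of_nat (n + 2) * of_nat (n + 1)) * z ^ (n + 2)" for n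
  proof -
    have "c (n + 2) + c (n + 1) = (-1) ^ n * (1 / of_nat (n + 1) - 1 / of_nat (n + 2))"
      by (simp add: c_def divide_inverse algebra_simps)
    also have "1 / of_nat (n + 1) - 1 / of_nat (n + 2) = (1 / (of_nat (n + 2) * of_nat (n + 1)) :: complex)"
    proof -
      define x :: complex where "x = of_nat (n + 1)"
      have "x \<noteq> 0" "x + 1 \<noteq> 0" and x: "of_nat (n + 2) = x + 1"
        unfolding x_def by (simp_all flip: of_nat_Suc add: add_ac del: of_nat_add)
      then show ?thesis
        by (simp add: x flip: x_def) (simp add: field_simps)
    qed
    finally have "c (n + 2) + c (n + 1) = (-1) ^ n / (of_nat (n + 2) * of_nat (n + 1))"
      by simp
    moreover have "c (n + 2) * z ^ (n + 2) + z * (c (n + 1) * z ^ (n + 1)) = (c (n + 2) + c (n + 1)) * z ^ (n + 2)"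
      by (simp add: algebra_simps)
    ultimately show ?thesis by simp
  qed
  ultimately show ?thesis
    by (simp add: algebra_simps)
qed

text \<open>The case \<open>z = - r\<close> of the complex series, where all signs become positive.
  It gives the majorant of the Bohr series in closed form.\<close>

lemma sums_one_minus_times_ln:
  fixes r :: real
  assumes "0 \<le> r" "r < 1"
  shows "(\<lambda>n. r ^ (n + 2) / (real (n + 2) * real (n + 1))) sums (r + (1 - r) * ln (1 - r))"
proof -
  have e: "(-1) ^ n / (of_nat (n + 2) * of_nat (n + 1)) * (- of_real r) ^ (n + 2)
      = (of_real (r ^ (n + 2) / (real (n + 2) * real (n + 1))) :: complex)" for n
  proof -
    have "(- complex_of_real r) ^ (n + 2) = (-1) ^ n * of_real r ^ (n + 2)"
      by (simp add: power_minus[of "complex_of_real r"])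
    then show ?thesis
      by (simp flip: power_mult_distrib)
  qed
  have "Ln (1 + - of_real r) = of_real (ln (1 - r))"
    using Ln_of_real[of "1 - r"] assms by simp
  then have "(1 + - complex_of_real r) * Ln (1 + - of_real r) - - of_real r = of_real (r + (1 - r) * ln (1 - r))"
    by simp
  then have "(\<lambda>n. complex_of_real (r ^ (n + 2) / (real (n + 2) * real (n + 1)))) sums of_real (r + (1 - r) * ln (1 - r))"
    using sums_one_plus_times_Ln[of "- of_real r"] assms unfolding e by (simp add: add.commute)
  then show ?thesis
    by (simp only: sums_of_real_iff)
qed

text \<open>The derivative \<open>- ln (1 - x)\<close> is positive for \<open>0 < x < 1\<close> but
  vanishes at \<open>0\<close>, hence the criterion that looks at the open interval only.\<close>

lemma strict_mono_one_minus_times_ln: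
  fixes r s :: real
  assumes "0 \<le> r" "r < s" "s < 1"
  shows "r + (1 - r) * ln (1 - r) < s + (1 - s) * ln (1 - s)"
proof (rule DERIV_pos_imp_increasing_open[OF assms(2)])
  fix x assume x: "r < x" "x < s"
  have "((\<lambda>x. x + (1 - x) * ln (1 - x)) has_real_derivative (- ln (1 - x))) (at x)"
    using x assms by (auto intro!: derivative_eq_intros)
  moreover have "- ln (1 - x) > 0"
    using x assms by simp
  ultimately show "\<exists>y. ((\<lambda>x. x + (1 - x) * ln (1 - x)) has_real_derivative y) (at x) \<and> y > 0"
    by blast
next
  show "continuous_on {r..s} (\<lambda>x. x + (1 - x) * ln (1 - x))"
    using assms by (intro continuous_intros) auto
qed

section \<open>Analytic functions with positive real part\<close>

text \<open>Cauchy's formula on \<open>|z| = r\<close>, where \<open>dz = 2 pi i z dt\<close>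
  cancels one power of \<open>z\<close> in the denominator. The case \<open>n = 0\<close> is the
  mean value property.\<close>

lemma circle_integral_higher_deriv:
  assumes holf: "f holomorphic_on ball 0 1" and r: "0 < r" "r < 1"
  shows "((\<lambda>t. f (circlepath 0 r t) / circlepath 0 r t ^ n) has_integral (deriv ^^ n) f 0 / fact n) {0..1}"
proof -
  have "((\<lambda>u. f u / (u - 0) ^ Suc n) has_contour_integral (2 * pi * \<i>) / fact n * (deriv ^^ n) f 0) (circlepath 0 r)"
    using r by (intro Cauchy_has_contour_integral_higher_derivative_circlepath
      holomorphic_on_imp_continuous_on holomorphic_on_subset[OF holf]) auto
  then have "((\<lambda>t. f (circlepath 0 r t) / circlepath 0 r t ^ Suc n * (2 * pi * \<i> * circlepath 0 r t))
      has_integral (2 * pi * \<i>) / fact n * (deriv ^^ n) f 0) {0..1}"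
    unfolding has_contour_integral vector_derivative_circlepath by (simp add: circlepath mult_ac)
  then have "((\<lambda>t. f (circlepath 0 r t) / circlepath 0 r t ^ Suc n * (2 * pi * \<i> * circlepath 0 r t) / (2 * pi * \<i>))
      has_integral (2 * pi * \<i>) / fact n * (deriv ^^ n) f 0 / (2 * pi * \<i>)) {0..1}"
    by (rule has_integral_divide)
  moreover have "circlepath 0 r t \<noteq> 0" for t
    using r by (simp add: circlepath)
  ultimately show ?thesis
    by (simp add: field_simps)
qed

text \<open>In the integral for the coefficient, \<open>f\<close> may be replaced by
  \<open>2 Re f\<close>. The norm is then at most the mean of \<open>2 Re f / r ^ n\<close>, which
  is \<open>2 Re (f 0) / r ^ n\<close>; finally \<open>r\<close> tends to \<open>1\<close>.\<close>

lemma Caratheodory_coefficient_bound: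
  assumes holf: "f holomorphic_on ball 0 1"
    and Re_nonneg: "\<And>z. norm z < 1 \<Longrightarrow> 0 \<le> Re (f z)" and "n > 0"
  shows "norm ((deriv ^^ n) f 0 / fact n) \<le> 2 * Re (f 0)"
proof -
  define p where "p = (deriv ^^ n) f 0 / fact n"
  have le: "norm p * r ^ n \<le> 2 * Re (f 0)" if r: "0 < r" "r < 1" for r
  proof -
    define \<gamma> where "\<gamma> = circlepath 0 r"
    have norm_\<gamma>: "norm (\<gamma> t) = r" for t
      using r by (simp add: \<gamma>_def circlepath norm_mult)
    have [simp]: "\<gamma> t \<noteq> 0" for t
      using norm_\<gamma>[of t] r by auto
    \<comment> \<open>On the circle \<open>1 / \<gamma>\<close> is
      \<open>cnj \<gamma> / r ^ 2\<close>; in this form the kernel matches the one in the conjugated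
      integral below.\<close>
    have inv: "1 / \<gamma> t ^ n = cnj (\<gamma> t) ^ n / of_real (r ^ (2 * n))" for t
    proof -
      have "\<gamma> t * cnj (\<gamma> t) = of_real (r\<^sup>2)"
        using complex_norm_square[of "\<gamma> t"] norm_\<gamma>[of t] by simp
      then have "\<gamma> t ^ n * cnj (\<gamma> t) ^ n = of_real (r ^ (2 * n))"
        by (metis power_mult_distrib of_real_power power_mult)
      then show ?thesis
        using r by (simp add: field_simps)
    qed
    have "((\<lambda>t. f (\<gamma> t) / \<gamma> t ^ n) has_integral p) {0..1}"
      unfolding \<gamma>_def p_def by (rule circle_integral_higher_deriv[OF holf r])
    then have i1: "((\<lambda>t. f (\<gamma> t) * cnj (\<gamma> t) ^ n / of_real (r ^ (2 * n))) has_integral p) {0..1}"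
      using inv by (simp add: divide_inverse mult.assoc)
    \<comment> \<open>As \<open>n > 0\<close>, this function vanishes at \<open>0\<close> and has
      mean \<open>0\<close>. Its conjugate supplies the \<open>cnj f\<close> that completes
      \<open>f\<close> to \<open>2 Re f\<close>.\<close>
    have "(\<lambda>z. f z * z ^ n) holomorphic_on ball 0 1"
      by (intro holomorphic_intros holf)
    from circle_integral_higher_deriv[OF this r, of 0]
    have "((\<lambda>t. f (\<gamma> t) * \<gamma> t ^ n) has_integral 0) {0..1}"
      using \<open>n > 0\<close> by (simp add: \<gamma>_def zero_power)
    from has_integral_divide[OF has_integral_linear[OF this bounded_linear_cnj], of "of_real (r ^ (2 * n))"]
    have "((\<lambda>t. cnj (f (\<gamma> t) * \<gamma> t ^ n) / of_real (r ^ (2 * n))) has_integral 0) {0..1}"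
      by (simp add: o_def)
    from has_integral_add[OF i1 this]
    have i2: "((\<lambda>t. of_real (2 * Re (f (\<gamma> t))) * cnj (\<gamma> t) ^ n / of_real (r ^ (2 * n))) has_integral p) {0..1}"
      by (simp add: add_divide_distrib[symmetric] distrib_right[symmetric] complex_add_cnj del: of_real_power)
    have "((\<lambda>t. f (\<gamma> t)) has_integral f 0) {0..1}"
      using circle_integral_higher_deriv[OF holf r, of 0] by (simp add: \<gamma>_def)
    from has_integral_mult_right[OF has_integral_Re[OF this], of "2 / r ^ n"]
    have i3: "((\<lambda>t. 2 / r ^ n * Re (f (\<gamma> t))) has_integral 2 / r ^ n * Re (f 0)) {0..1}" .
    have "norm (of_real (2 * Re (f (\<gamma> t))) * cnj (\<gamma> t) ^ n / of_real (r ^ (2 * n))) \<le> 2 / r ^ n * Re (f (\<gamma> t))" for t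
    proof -
      have "0 \<le> Re (f (\<gamma> t))"
        using Re_nonneg norm_\<gamma> r by simp
      then have "norm (of_real (2 * Re (f (\<gamma> t))) * cnj (\<gamma> t) ^ n / of_real (r ^ (2 * n)))
          = 2 * Re (f (\<gamma> t)) * r ^ n / r ^ (2 * n)"
        using r unfolding norm_mult norm_divide norm_power norm_of_real complex_mod_cnj norm_\<gamma>
        by (metis abs_of_nonneg less_eq_real_def mult_nonneg_nonneg zero_le_numeral zero_le_power)
      also have "\<dots> = 2 / r ^ n * Re (f (\<gamma> t))"
        using r unfolding mult_2 power_add by simp
      finally show ?thesis by simp
    qed
    then have "norm p \<le> 2 / r ^ n * Re (f 0)"
      using has_integral_norm_bound_integral_component[OF i2 i3, of 1] by simp
    then show ?thesis
      using r by (simp add: field_simps)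
  qed
  have "((\<lambda>r. norm p * r ^ n) \<longlongrightarrow> norm p * 1 ^ n) (at_left 1)"
    by (intro tendsto_intros)
  moreover have "eventually (\<lambda>r :: real. norm p * r ^ n \<le> 2 * Re (f 0)) (at_left 1)"
    by (rule eventually_mono[OF eventually_at_left_real[of 0 1]]) (use le in auto)
  ultimately have "norm p * 1 ^ n \<le> 2 * Re (f 0)"
    by (rule tendsto_upperbound) simp
  then show ?thesis
    by (simp add: p_def)
qed

text \<open>The Cayley transform \<open>(f - M) / (f + M)\<close> maps the disc into itself and
  fixes \<open>0\<close>, so Schwarz's lemma gives \<open>|f - M| \<le> |z| |f + M|\<close>, which
  is then solved for \<open>Re f\<close>.\<close>

lemma Harnack_lower_bound:
  assumes holf: "f holomorphic_on ball 0 1" and M: "f 0 = of_real M" "M > 0"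
    and Re_pos: "\<And>z. norm z < 1 \<Longrightarrow> 0 < Re (f z)" and z: "norm z < 1"
  shows "M * (1 - norm z) / (1 + norm z) \<le> Re (f z)"
proof -
  define w where "w z = (f z - M) / (f z + M)" for z
  have ne: "f z + M \<noteq> 0" if "norm z < 1" for z
    using Re_pos[OF that] M by (auto simp: complex_eq_iff)
  have "norm (w z) \<le> norm z"
  proof (rule Schwarz_Lemma(1)[OF _ _ _ z])
    show "w holomorphic_on ball 0 1"
      unfolding w_def using ne by (intro holomorphic_intros holf) auto
    show "w 0 = 0"
      by (simp add: w_def M)
    fix z :: complex assume z: "norm z < 1"
    have "(norm (f z - M))\<^sup>2 < (norm (f z + M))\<^sup>2"
      unfolding cmod_power2 using mult_pos_pos[OF Re_pos[OF z] M(2)] by (simp add: power2_eq_square algebra_simps)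
    then show "norm (w z) < 1"
      using ne[OF z] by (simp add: w_def norm_divide power_less_imp_less_base)
  qed
  then have "norm (f z - M) \<le> norm z * norm (f z + M)"
    using ne[OF z] by (simp add: w_def norm_divide field_simps)
  then have "(norm (f z - M))\<^sup>2 \<le> (norm z * norm (f z + M))\<^sup>2"
    by (rule power_mono) simp
  define r where "r = norm z"
  define x where "x = Re (f z)"
  have r: "0 \<le> r" "r < 1" and x: "0 < x"
    using z Re_pos by (auto simp: r_def x_def)
  have "(x - M)\<^sup>2 + (Im (f z))\<^sup>2 \<le> r\<^sup>2 * ((x + M)\<^sup>2 + (Im (f z))\<^sup>2)"
    using \<open>_ \<le> (norm z * norm (f z + M))\<^sup>2\<close> unfolding power_mult_distrib by (simp add: cmod_power2 r_def x_def)
  moreover have "r\<^sup>2 * (Im (f z))\<^sup>2 \<le> (Im (f z))\<^sup>2"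
    using r by (simp add: mult_left_le_one_le power_le_one)
  ultimately have "(x - M)\<^sup>2 \<le> (r * (x + M))\<^sup>2"
    unfolding power_mult_distrib[of r] distrib_left[of "r\<^sup>2"] by linarith
  then have "\<bar>x - M\<bar> \<le> r * (x + M)"
    using r x M by (simp add: abs_le_square_iff[symmetric] abs_mult)
  then have "M * (1 - r) \<le> x * (1 + r)"
    by (simp add: algebra_simps)
  then show ?thesis
    using pos_divide_le_eq[of "1 + r" "M * (1 - r)" x] r unfolding r_def x_def by simp
qed

section \<open>Uniqueness of the harmonic decomposition\<close>

text \<open>A nonconstant holomorphic map is open, so its image would contain points just above a
  real value.\<close>

lemma holomorphic_real_valued_constant:
  assumes holf: "f holomorphic_on S" and S: "open S" "connected S"
    and "\<And>z. z \<in> S \<Longrightarrow> Im (f z) = 0"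
  shows "f constant_on S"
proof (rule ccontr)
  assume nc: "\<not> f constant_on S"
  then have "S \<noteq> {}"
    by (auto simp: constant_on_def)
  then obtain z where z: "z \<in> S" by blast
  have "open (f ` S)"
    by (rule open_mapping_thm[OF holf S S(1) subset_refl nc])
  then obtain e where e: "e > 0" "ball (f z) e \<subseteq> f ` S"
    using z by (meson imageI open_contains_ball)
  have "f z + \<i> * of_real (e / 2) \<in> ball (f z) e"
    using e by (simp add: dist_norm norm_mult)
  then obtain y where "y \<in> S" "f z + \<i> * of_real (e / 2) = f y"
    using e by blast
  then have "Im (f z + \<i> * of_real (e / 2)) = 0"
    using assms(4) by simp
  then show False
    using assms(4)[OF z] e by simp
qed

lemma holomorphic_plus_cnj_eq_0:
  assumes hol: "f holomorphic_on S" "g holomorphic_on S" and S: "open S" "connected S"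
    and eq: "\<And>z. z \<in> S \<Longrightarrow> f z + cnj (g z) = 0"
    and z0: "z0 \<in> S" "f z0 = 0" and z: "z \<in> S"
  shows "f z = 0 \<and> g z = 0"
proof -
  have f: "f z = - cnj (g z)" if "z \<in> S" for z
    using eq[OF that] by (simp add: eq_neg_iff_add_eq_0)
  have g0: "g z0 = 0"
    using f[OF z0(1)] z0 by simp
  \<comment> \<open>since \<open>f = - cnj g\<close>, both \<open>f - g\<close> and \<open>\<i> (f + g)\<close> are real-valued\<close>
  have "(\<lambda>z. f z - g z) constant_on S"
    by (intro holomorphic_real_valued_constant S holomorphic_intros hol) (simp add: f)
  then have "f z - g z = 0"
    using z z0 g0 unfolding constant_on_def by (metis diff_zero)
  moreover have "(\<lambda>z. \<i> * (f z + g z)) constant_on S"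
    by (intro holomorphic_real_valued_constant S holomorphic_intros hol) (simp add: f)
  then have "\<i> * (f z + g z) = 0"
    using z z0 g0 unfolding constant_on_def by (metis add.right_neutral mult_zero_right)
  ultimately show ?thesis
    by (simp add: eq_neg_iff_add_eq_0 complex_eq_iff)
qed

text \<open>Padding the coefficients with zeros below index \<open>2\<close> turns the shifted
  series into an ordinary power series.\<close>

lemma powser_shift2_holomorphic:
  fixes c :: "nat \<Rightarrow> complex"
  assumes "\<And>z. z \<in> ball 0 1 \<Longrightarrow> summable (\<lambda>n. c (n + 2) * z ^ (n + 2))"
  defines "F \<equiv> (\<lambda>z. \<Sum>n. c (n + 2) * z ^ (n + 2))"
  shows "F holomorphic_on ball 0 1"
    and "F has_fps_expansion Abs_fps (\<lambda>n. if n < 2 then 0 else c n)"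
proof -
  define d where "d n = (if n < 2 then 0 else c n)" for n
  have sums: "(\<lambda>n. d n * z ^ n) sums F z" if "z \<in> ball 0 1" for z
  proof -
    have "(\<lambda>n. d (n + 2) * z ^ (n + 2)) sums F z"
      using summable_sums[OF assms(1)[OF that]] by (simp add: F_def d_def)
    moreover have "(\<Sum>i<2. d i * z ^ i) = 0"
      by (simp add: d_def)
    ultimately show ?thesis
      using sums_iff_shift[of "\<lambda>n. d n * z ^ n" 2 "F z"] by simp
  qed
  show "F holomorphic_on ball 0 1"
  proof (rule power_series_holomorphic)
    fix z :: complex assume "z \<in> ball 0 1"
    from sums[OF this] show "(\<lambda>n. d n * (z - 0) ^ n) sums F z" by simp
  qed
  have "eventually (\<lambda>z. z \<in> ball (0 :: complex) 1) (nhds 0)"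
    by (intro eventually_nhds_in_open) auto
  then have "eventually (\<lambda>z. (\<lambda>n. fps_nth (Abs_fps d) n * z ^ n) sums F z) (nhds 0)"
    by (rule eventually_mono) (simp add: sums)
  then have "F has_fps_expansion Abs_fps d"
    by (rule has_fps_expansionI)
  then show "F has_fps_expansion Abs_fps (\<lambda>n. if n < 2 then 0 else c n)"
    unfolding d_def .
qed

text \<open>The class and the expansion split the same \<open>f\<close> in two ways;
  \<open>holomorphic_plus_cnj_eq_0\<close> applies to the differences of the parts, normalised at
  \<open>0\<close>.\<close>

lemma harmonic_expansion_unique:
  assumes dec: "H0_decomposition f h g" and exp: "harmonic_expansion f a b"
    and z: "z \<in> ball 0 1"
  shows "h z = z + (\<Sum>n. a (n + 2) * z ^ (n + 2))" "g z = (\<Sum>n. b (n + 2) * z ^ (n + 2))"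
proof -
  define A where "A = (\<lambda>z. \<Sum>n. a (n + 2) * z ^ (n + 2))"
  define B where "B = (\<lambda>z. \<Sum>n. b (n + 2) * z ^ (n + 2))"
  have hol: "A holomorphic_on ball 0 1" "B holomorphic_on ball 0 1"
    unfolding A_def B_def using exp
    by (auto intro!: powser_shift2_holomorphic(1) simp: harmonic_expansion_def simp del: power_Suc add_2_eq_Suc' mem_ball)
  have "(h z - (z + A z)) = 0 \<and> (g z - B z) = 0"
  proof (rule holomorphic_plus_cnj_eq_0[where S = "ball 0 1" and ?z0.0 = 0 and z = z
        and f = "\<lambda>z. h z - (z + A z)" and g = "\<lambda>z. g z - B z"])
    show "(\<lambda>z. h z - (z + A z)) holomorphic_on ball 0 1" "(\<lambda>z. g z - B z) holomorphic_on ball 0 1"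
      using dec by (auto intro!: holomorphic_intros hol simp: H0_decomposition_def)
    show "h 0 - (0 + A 0) = 0"
      using dec by (simp add: A_def H0_decomposition_def)
    fix z :: complex assume z: "z \<in> ball 0 1"
    then have "f z = h z + cnj (g z)" "f z = z + A z + cnj (B z)"
      using dec exp unfolding H0_decomposition_def harmonic_expansion_def A_def B_def by blast+
    then show "h z - (z + A z) + cnj (g z - B z) = 0"
      by (simp add: algebra_simps)
  qed (use z in auto)
  then show "h z = z + (\<Sum>n. a (n + 2) * z ^ (n + 2))" "g z = (\<Sum>n. b (n + 2) * z ^ (n + 2))"
    by (simp_all add: A_def B_def)
qed

section \<open>Radial growth of an analytic function\<close>

text \<open>The bound solves \<open>y'' = - 2 M / (1 + r)\<close> with \<open>y 0 = 0\<close> and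
  \<open>y' 0 = 1\<close>. Harnack's inequality compares second derivatives along the radius through
  \<open>w\<close>; the two integrations are monotonicity arguments for \<open>v\<close> and
  \<open>u\<close>.\<close>

lemma growth_lower_bound:
  assumes holF: "F holomorphic_on ball 0 1" and F0: "F 0 = 0" "deriv F 0 = 1" and M: "M > 0"
    and Re_F: "\<And>z. norm z < 1 \<Longrightarrow> - M < Re (z * deriv (deriv F) z)"
    and w: "norm w = 1" and r: "0 \<le> r" "r < 1"
  shows "r - 2 * M * ((1 + r) * ln (1 + r) - r) \<le> Re (cnj w * F (of_real r * w))"
proof -
  have holF': "deriv F holomorphic_on ball 0 1" and holF'': "deriv (deriv F) holomorphic_on ball 0 1"
    using holF by (auto intro!: holomorphic_deriv)
  have inD: "of_real t * w \<in> ball 0 1" if "0 \<le> t" "t < 1" for t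
    using that w by (simp add: norm_mult)
  have second: "- 2 * M / (1 + t) \<le> Re (w * deriv (deriv F) (of_real t * w))" if t: "0 < t" "t < 1" for t
  proof -
    \<comment> \<open>\<open>P\<close> has positive real part and \<open>P 0 = M\<close>. Harnack's
      bound minus \<open>M\<close> contains a factor \<open>t\<close>, which is divided out; hence
      \<open>0 < t\<close>.\<close>
    define P where "P z = M + z * deriv (deriv F) z" for z
    have "M * (1 - norm (t * w)) / (1 + norm (t * w)) \<le> Re (P (t * w))"
      using M inD[of t] t Re_F by (intro Harnack_lower_bound)
        (force simp: P_def intro!: holomorphic_intros holF'')+
    then have "M * (1 - t) / (1 + t) - M \<le> Re (t * w * deriv (deriv F) (t * w))"
      using w t by (simp add: P_def norm_mult)
    also have "M * (1 - t) / (1 + t) - M = t * (- 2 * M / (1 + t))"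
      using t by (simp add: field_simps)
    also have "Re (t * w * deriv (deriv F) (t * w)) = t * Re (w * deriv (deriv F) (t * w))"
      by (simp add: mult.assoc)
    finally show ?thesis
      using t by (simp only: mult_le_cancel_left_pos)
  qed
  have der1: "((\<lambda>t. F (of_real t * w)) has_vector_derivative (w * deriv F (of_real t * w))) (at t)"
    and der2: "((\<lambda>t. deriv F (of_real t * w)) has_vector_derivative (w * deriv (deriv F) (of_real t * w))) (at t)"
    if t: "0 \<le> t" "t < 1" for t
  proof -
    have lin: "((\<lambda>t. of_real t * w) has_vector_derivative w) (at t)"
      by (auto intro!: derivative_eq_intros simp: has_vector_derivative_def scaleR_conv_of_real)
    have "(F has_field_derivative deriv F (of_real t * w)) (at (of_real t * w))"
      using holomorphic_derivI[OF holF open_ball inD[OF t]] .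
    from field_vector_diff_chain_at[OF lin this]
    show "((\<lambda>t. F (of_real t * w)) has_vector_derivative (w * deriv F (of_real t * w))) (at t)"
      by (simp add: o_def)
    have "(deriv F has_field_derivative deriv (deriv F) (of_real t * w)) (at (of_real t * w))"
      using holomorphic_derivI[OF holF' open_ball inD[OF t]] .
    from field_vector_diff_chain_at[OF lin this]
    show "((\<lambda>t. deriv F (of_real t * w)) has_vector_derivative (w * deriv (deriv F) (of_real t * w))) (at t)"
      by (simp add: o_def)
  qed
  \<comment> \<open>First integration: \<open>v\<close> increases from
    \<open>v 0 = Re (deriv F 0) = 1\<close>.\<close>
  define v where "v t = Re (deriv F (of_real t * w)) + 2 * M * ln (1 + t)" for t
  have derv: "(v has_real_derivative Re (w * deriv (deriv F) (of_real t * w)) + 2 * M / (1 + t)) (at t)"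
    if t: "0 \<le> t" "t < 1" for t
    unfolding v_def using t
    by (auto intro!: derivative_eq_intros has_field_derivative_Re der2)
  have v: "1 \<le> v t" if t: "0 \<le> t" "t < 1" for t
  proof -
    have "v 0 \<le> v t"
    proof (rule DERIV_nonneg_imp_increasing_open[OF t(1)])
      fix s assume s: "0 < s" "s < t"
      then show "\<exists>y. (v has_real_derivative y) (at s) \<and> 0 \<le> y"
        using derv[of s] second[of s] t by (intro exI[of _ "Re (w * deriv (deriv F) (of_real s * w)) + 2 * M / (1 + s)"]) auto
    next
      show "continuous_on {0..t} v"
        using t by (intro continuous_at_imp_continuous_on ballI DERIV_isCont[OF derv]) auto
    qed
    then show ?thesis
      by (simp add: v_def F0)
  qed
  \<comment> \<open>Second integration: \<open>u\<close> has derivative \<open>v - 1\<close>, which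
    is nonnegative, and \<open>u 0 = 0\<close>.\<close>
  define u where "u t = Re (cnj w * F (of_real t * w)) - t + 2 * M * ((1 + t) * ln (1 + t) - t)" for t
  have deru: "(u has_real_derivative v t - 1) (at t)" if t: "0 \<le> t" "t < 1" for t
  proof -
    \<comment> \<open>On the unit circle \<open>cnj w\<close> undoes the factor \<open>w\<close>
      that the chain rule produces.\<close>
    have cancel: "cnj w * (w * x) = x" for x
      using w complex_norm_square[of w] by (metis mult.assoc mult.commute mult_1 of_real_1 one_power2)
    have "((\<lambda>t. cnj w * F (of_real t * w)) has_vector_derivative deriv F (of_real t * w)) (at t)"
      using has_vector_derivative_mult_right[OF der1[OF t], of "cnj w"] unfolding cancel .
    then have "((\<lambda>t. Re (cnj w * F (of_real t * w))) has_real_derivative Re (deriv F (of_real t * w))) (at t)"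
      by (rule has_field_derivative_Re)
    moreover have "((\<lambda>t. 2 * M * ((1 + t) * ln (1 + t) - t)) has_real_derivative 2 * M * ln (1 + t)) (at t)"
      using t by (auto intro!: derivative_eq_intros)
    ultimately show ?thesis
      unfolding u_def v_def by (auto intro!: DERIV_cong[OF DERIV_add[OF DERIV_diff[OF _ DERIV_ident]]])
  qed
  have "u 0 \<le> u r"
  proof (rule DERIV_nonneg_imp_nondecreasing[OF r(1)])
    fix t assume "0 \<le> t" "t \<le> r"
    then show "\<exists>y. (u has_real_derivative y) (at t) \<and> 0 \<le> y"
      using deru[of t] v[of t] r by (intro exI[of _ "v t - 1"]) auto
  qed
  then show ?thesis
    by (simp add: u_def F0)
qed

section \<open>Coefficient and growth bounds for the harmonic class\<close>

lemma deriv_id_plus_eps: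
  assumes "H0_decomposition f h g" "z \<in> ball 0 1"
  shows "deriv (\<lambda>z. h z + \<epsilon> * g z) z = deriv h z + \<epsilon> * deriv g z"
    and "deriv (deriv (\<lambda>z. h z + \<epsilon> * g z)) z = deriv (deriv h) z + \<epsilon> * deriv (deriv g) z"
proof -
  have hol: "h holomorphic_on ball 0 1" "g holomorphic_on ball 0 1"
    using assms(1) by (auto simp: H0_decomposition_def)
  have hol': "deriv h holomorphic_on ball 0 1" "deriv g holomorphic_on ball 0 1"
    using hol by (auto intro: holomorphic_deriv)
  have dh: "(h has_field_derivative deriv h z) (at z)" "(deriv h has_field_derivative deriv (deriv h) z) (at z)"
    and dg: "(g has_field_derivative deriv g z) (at z)" "(deriv g has_field_derivative deriv (deriv g) z) (at z)"
    if "z \<in> ball 0 1" for z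
    using hol hol' that by (auto intro: holomorphic_derivI)
  have d1: "deriv (\<lambda>z. h z + \<epsilon> * g z) z = deriv h z + \<epsilon> * deriv g z" if "z \<in> ball 0 1" for z
    by (intro DERIV_imp_deriv DERIV_add DERIV_cmult dh dg that)
  then show "deriv (\<lambda>z. h z + \<epsilon> * g z) z = deriv h z + \<epsilon> * deriv g z"
    using assms(2) .
  have "deriv (deriv (\<lambda>z. h z + \<epsilon> * g z)) z = deriv (\<lambda>z. deriv h z + \<epsilon> * deriv g z) z"
    using assms(2) by (intro deriv_cong_ev eventually_mono[OF eventually_nhds_in_open[of "ball 0 1"]]) (auto simp: d1)
  also have "\<dots> = deriv (deriv h) z + \<epsilon> * deriv (deriv g) z"
    by (intro DERIV_imp_deriv DERIV_add DERIV_cmult dh dg assms(2))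
  finally show "deriv (deriv (\<lambda>z. h z + \<epsilon> * g z)) z = deriv (deriv h) z + \<epsilon> * deriv (deriv g) z" .
qed

text \<open>The real part of \<open>\<epsilon> z g''\<close> is at least \<open>- |z g''|\<close>,
  which the defining inequality absorbs. The pair \<open>h\<close>, \<open>g\<close> is fixed before
  \<open>\<epsilon>\<close>, whose later choice depends on \<open>n\<close> or on
  \<open>z\<close>.\<close>

lemma PH0_rotation:
  assumes "f \<in> PH0 M"
  obtains h g where "H0_decomposition f h g"
    "\<And>\<epsilon> z. norm \<epsilon> = 1 \<Longrightarrow> norm z < 1 \<Longrightarrow> - M < Re (z * deriv (deriv (\<lambda>z. h z + \<epsilon> * g z)) z)"
proof -
  from assms obtain h g where hg: "H0_decomposition f h g"
    "\<And>z. z \<in> ball 0 1 \<Longrightarrow> Re (z * deriv (deriv h) z) > - M + cmod (z * deriv (deriv g) z)"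
    unfolding PH0_def by blast
  have "- M < Re (z * deriv (deriv (\<lambda>z. h z + \<epsilon> * g z)) z)" if e: "norm \<epsilon> = 1" and z: "norm z < 1" for \<epsilon> z
  proof -
    have "- cmod (z * deriv (deriv g) z) \<le> Re (\<epsilon> * (z * deriv (deriv g) z))"
      using complex_Re_le_cmod[of "- (\<epsilon> * (z * deriv (deriv g) z))"] e by (simp add: norm_mult)
    moreover have "z * deriv (deriv (\<lambda>z. h z + \<epsilon> * g z)) z = z * deriv (deriv h) z + \<epsilon> * (z * deriv (deriv g) z)"
      using deriv_id_plus_eps(2)[OF hg(1), of z \<epsilon>] z by (simp add: algebra_simps)
    ultimately show ?thesis
      using hg(2)[of z] z by simp
  qed
  with hg(1) that show thesis by blast
qed

lemma exists_aligning_rotation: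
  fixes x y :: complex
  obtains \<epsilon> where "norm \<epsilon> = 1" "norm (x + \<epsilon> * y) = norm x + norm y"
proof (cases "x = 0 \<or> y = 0")
  case True
  then show thesis by (intro that[of 1]) auto
next
  case False
  \<comment> \<open>\<open>sgn\<close> is the unit direction of a nonzero number, so
    \<open>y\<close> is rotated onto the ray through \<open>x\<close>.\<close>
  define \<epsilon> where "\<epsilon> = sgn x / sgn y"
  have "\<epsilon> * y = sgn x * of_real (norm y)"
    using False by (simp add: \<epsilon>_def sgn_eq)
  then have "x + \<epsilon> * y = sgn x * of_real (norm x + norm y)"
    using False by (simp add: sgn_eq field_simps)
  moreover have "norm (sgn x * of_real (norm x + norm y)) = norm x + norm y"
    using False unfolding norm_mult norm_of_real norm_sgn by simp
  ultimately show thesis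
    using False by (intro that[of \<epsilon>]) (simp_all add: \<epsilon>_def norm_divide norm_sgn)
qed

text \<open>Caratheodory's inequality for \<open>M + z F''\<close> with
  \<open>F = h + \<epsilon> g\<close>, where \<open>\<epsilon>\<close> makes the moduli of the two
  coefficients add. The coefficient is read off by formal power series.\<close>

lemma PH0_coefficient_bound:
  assumes f: "f \<in> PH0 M" and exp: "harmonic_expansion f a b"
  shows "real (n + 2) * real (n + 1) * (cmod (a (n + 2)) + cmod (b (n + 2))) \<le> 2 * M"
proof -
  from PH0_rotation[OF f] obtain h g where hg: "H0_decomposition f h g"
    and Re_pos: "\<And>\<epsilon> z. norm \<epsilon> = 1 \<Longrightarrow> norm z < 1 \<Longrightarrow> - M < Re (z * deriv (deriv (\<lambda>z. h z + \<epsilon> * g z)) z)"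
    by blast
  obtain \<epsilon> where \<epsilon>: "norm \<epsilon> = 1"
    "norm (a (n + 2) + \<epsilon> * b (n + 2)) = norm (a (n + 2)) + norm (b (n + 2))"
    by (rule exists_aligning_rotation)
  define F where "F = (\<lambda>z. h z + \<epsilon> * g z)"
  define P where "P z = of_real M + z * deriv (deriv F) z" for z
  define A where "A = (\<lambda>z. \<Sum>n. a (n + 2) * z ^ (n + 2))"
  define B where "B = (\<lambda>z. \<Sum>n. b (n + 2) * z ^ (n + 2))"
  define S where "S c = Abs_fps (\<lambda>n. if n < 2 then 0 else c n)" for c :: "nat \<Rightarrow> complex"
  have AB: "A has_fps_expansion S a" "B has_fps_expansion S b"
    unfolding A_def B_def S_def using exp
    by (auto intro!: powser_shift2_holomorphic(2) simp: harmonic_expansion_def simp del: power_Suc add_2_eq_Suc' mem_ball)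
  have "(\<lambda>z. z + A z + \<epsilon> * B z) has_fps_expansion fps_X + S a + fps_const \<epsilon> * S b"
    by (intro fps_expansion_intros AB)
  moreover have "eventually (\<lambda>z. z \<in> ball (0 :: complex) 1) (nhds 0)"
    by (intro eventually_nhds_in_open) auto
  then have ev: "eventually (\<lambda>z. z + A z + \<epsilon> * B z = F z) (nhds 0)"
    by (rule eventually_mono) (simp only: F_def A_def B_def harmonic_expansion_unique[OF hg exp])
  ultimately have "F has_fps_expansion fps_X + S a + fps_const \<epsilon> * S b"
    unfolding has_fps_expansion_cong[OF ev refl] by simp
  then have "P has_fps_expansion fps_const (of_real M) + fps_X * fps_deriv (fps_deriv (fps_X + S a + fps_const \<epsilon> * S b))"
    unfolding P_def by (intro fps_expansion_intros)
  \<comment> \<open>Two derivatives lower the index by \<open>2\<close> and the factor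
    \<open>z\<close> raises it by \<open>1\<close>, so index \<open>n + 2\<close> of
    \<open>F\<close> shows up at index \<open>n + 1\<close> of \<open>P\<close>, which is positive
    as required by Caratheodory's inequality.\<close>
  then have "(deriv ^^ (n + 1)) P 0 / fact (n + 1)
      = fps_nth (fps_const (of_real M) + fps_X * fps_deriv (fps_deriv (fps_X + S a + fps_const \<epsilon> * S b))) (n + 1)"
    by (simp only: fps_nth_fps_expansion)
  also have "\<dots> = of_nat (n + 2) * of_nat (n + 1) * (a (n + 2) + \<epsilon> * b (n + 2))"
    by (simp add: S_def algebra_simps)
  finally have "norm (of_nat (n + 2) * of_nat (n + 1) * (a (n + 2) + \<epsilon> * b (n + 2))) = norm ((deriv ^^ (n + 1)) P 0 / fact (n + 1))"
    by simp
  also have "\<dots> \<le> 2 * Re (P 0)"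
  proof (rule Caratheodory_coefficient_bound)
    have "F holomorphic_on ball 0 1"
      using hg unfolding F_def H0_decomposition_def by (auto intro!: holomorphic_intros)
    then show "P holomorphic_on ball 0 1"
      unfolding P_def by (intro holomorphic_intros holomorphic_deriv) auto
    show "0 \<le> Re (P z)" if "norm z < 1" for z
      using Re_pos[OF \<epsilon>(1) that] by (simp add: P_def F_def)
  qed simp
  also have "2 * Re (P 0) = 2 * M"
    by (simp add: P_def)
  finally show ?thesis
    unfolding norm_mult norm_of_nat \<epsilon>(2) .
qed

text \<open>With \<open>F = h + w^2 g\<close> and \<open>w\<close> the direction of
  \<open>z\<close>, \<open>cnj w F = cnj w h + w g\<close> has the same real part as
  \<open>cnj w f\<close>, so the analytic bound carries over to \<open>f\<close>.\<close>

lemma PH0_growth_lower_bound: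
  assumes f: "f \<in> PH0 M" and M: "M > 0" and z: "norm z < 1"
  shows "norm z - 2 * M * ((1 + norm z) * ln (1 + norm z) - norm z) \<le> cmod (f z)"
proof -
  from PH0_rotation[OF f] obtain h g where hg: "H0_decomposition f h g"
    and Re_pos: "\<And>\<epsilon> z. norm \<epsilon> = 1 \<Longrightarrow> norm z < 1 \<Longrightarrow> - M < Re (z * deriv (deriv (\<lambda>z. h z + \<epsilon> * g z)) z)"
    by blast
  \<comment> \<open>At \<open>0\<close> any unit direction serves, whereas \<open>sgn 0 = 0\<close>
    is not one.\<close>
  define w where "w = (if z = 0 then 1 else sgn z)"
  have w: "norm w = 1" "z = of_real (norm z) * w"
    by (simp add: w_def norm_sgn) (simp add: w_def sgn_eq)
  define F where "F = (\<lambda>z. h z + w\<^sup>2 * g z)"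
  have "F holomorphic_on ball 0 1"
    using hg unfolding F_def H0_decomposition_def by (auto intro!: holomorphic_intros)
  moreover have "F 0 = 0" "deriv F 0 = 1"
    using hg deriv_id_plus_eps(1)[OF hg, of 0 "w\<^sup>2"] by (auto simp: F_def H0_decomposition_def)
  moreover have "- M < Re (y * deriv (deriv F) y)" if "norm y < 1" for y
    unfolding F_def using w that by (intro Re_pos) (simp_all add: norm_power)
  ultimately have "norm z - 2 * M * ((1 + norm z) * ln (1 + norm z) - norm z) \<le> Re (cnj w * F (of_real (norm z) * w))"
    using w z M by (intro growth_lower_bound) auto
  also have "\<dots> = Re (cnj w * F z)"
    using w(2) by simp
  also have "cnj w * w\<^sup>2 = w"
    using w(1) complex_norm_square[of w] by (simp add: power2_eq_square mult.assoc[symmetric] mult.commute)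
  then have "cnj w * F z = cnj w * h z + w * g z"
    by (simp add: F_def distrib_left mult.assoc[symmetric])
  also have "Re (cnj w * h z + w * g z) = Re (cnj w * f z)"
    using hg z by (simp add: H0_decomposition_def algebra_simps)
  also have "\<dots> \<le> cmod (cnj w * f z)"
    by (rule complex_Re_le_cmod)
  also have "\<dots> = cmod (f z)"
    using w(1) by (simp add: norm_mult)
  finally show ?thesis .
qed

section \<open>The boundary distance\<close>

lemma radial_growth_limit:
  "((\<lambda>r :: real. r - 2 * M * ((1 + r) * ln (1 + r) - r)) \<longlongrightarrow> 1 + 2 * M * (1 - ln 4)) (at_left 1)"
proof -
  have "ln 4 = 2 * ln (2 :: real)"
    using ln_realpow[of 2 2] by simp
  then have "1 + 2 * M * (1 - ln 4) = 1 - 2 * M * ((1 + 1) * ln (1 + 1) - 1)"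
    by (simp add: algebra_simps)
  then show ?thesis
    by (simp only:) (intro tendsto_intros, auto)
qed

text \<open>The growth bound depends on \<open>|z|\<close> only, so its one-variable limit at
  \<open>1\<close> passes through \<open>filtercomap\<close> to the lower limit.\<close>

lemma boundary_dist_lower_bound:
  assumes f: "f \<in> PH0 M" and M: "M > 0"
  shows "ereal (1 + 2 * M * (1 - ln 4)) \<le> boundary_dist f"
proof -
  define L where "L r = r - 2 * M * ((1 + r) * ln (1 + r) - r)" for r :: real
  have f0: "f 0 = 0"
    using f by (auto simp: PH0_def H0_decomposition_def)
  have lim: "((\<lambda>r. ereal (L r)) \<longlongrightarrow> ereal (1 + 2 * M * (1 - ln 4))) (at_left 1)"
    unfolding L_def by (intro tendsto_intros radial_growth_limit)
  show ?thesis
    unfolding boundary_dist_def le_Liminf_iff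
  proof (intro allI impI)
    fix y assume "y < ereal (1 + 2 * M * (1 - ln 4))"
    then have "eventually (\<lambda>r. y < ereal (L r)) (at_left 1)"
      by (rule order_tendstoD(1)[OF lim])
    \<comment> \<open>Keeps \<open>z\<close> inside the disc, where the growth bound is
      available.\<close>
    moreover have "eventually (\<lambda>r :: real. r < 1) (at_left 1)"
      by (auto simp: eventually_at_filter)
    ultimately have "eventually (\<lambda>r. y < ereal (L r) \<and> r < 1) (at_left 1)"
      by (rule eventually_conj)
    then have "eventually (\<lambda>z :: complex. y < ereal (L (norm z)) \<and> norm z < 1) (filtercomap cmod (at_left 1))"
      by (rule eventually_filtercomapI)
    then show "eventually (\<lambda>z. y < ereal (cmod (f z - f 0))) (filtercomap cmod (at_left 1))"
    proof (rule eventually_mono)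
      fix z :: complex assume "y < ereal (L (norm z)) \<and> norm z < 1"
      then have "y < ereal (L (norm z))" "L (norm z) \<le> cmod (f z)"
        using PH0_growth_lower_bound[OF f M] by (auto simp: L_def)
      then show "y < ereal (cmod (f z - f 0))"
        by (simp add: f0 less_le_trans)
    qed
  qed
qed

text \<open>Eventual bounds for this filter follow from a condition on \<open>cmod z\<close> alone,
  so they hold in particular at \<open>of_real t\<close> for \<open>t\<close> near \<open>1\<close>,
  and persist in the limit.\<close>

lemma boundary_dist_le_radial_limit:
  assumes "((\<lambda>t. cmod (f (of_real t) - f 0)) \<longlongrightarrow> L) (at_left 1)"
  shows "boundary_dist f \<le> ereal L"
proof (rule dense_le)
  fix y assume "y < boundary_dist f"
  then have "eventually (\<lambda>z. y < ereal (cmod (f z - f 0))) (filtercomap cmod (at_left 1))"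
    unfolding boundary_dist_def by (rule less_LiminfD)
  then obtain Q where Q: "eventually Q (at_left 1)" "\<And>z. Q (cmod z) \<Longrightarrow> y < ereal (cmod (f z - f 0))"
    unfolding eventually_filtercomap by blast
  have "eventually (\<lambda>t. y \<le> ereal (cmod (f (of_real t) - f 0))) (at_left 1)"
    using Q(1) eventually_at_left_real[OF zero_less_one]
  proof eventually_elim
    fix t :: real assume "Q t" "t \<in> {0<..<1}"
    then show "y \<le> ereal (cmod (f (of_real t) - f 0))"
      using Q(2)[of "of_real t"] by simp
  qed
  then show "y \<le> ereal L"
    using assms by (intro tendsto_lowerbound[OF _ _ trivial_limit_at_left_real]) auto
qed

section \<open>The majorant of the Bohr sum\<close>

lemma sums_bohr_majorant:
  assumes "0 \<le> r" "r < 1"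
  shows "(\<lambda>n. C * (r ^ (n + 2) / (real (n + 2) * real (n + 1)))) sums (C * (r + (1 - r) * ln (1 - r)))"
  by (intro sums_mult sums_one_minus_times_ln assms)

text \<open>With \<open>N = (n + 2) (n + 1)\<close> and \<open>s\<close> the sum of the moduli,
  \<open>N (s + N s^2) = N s (N s + 1)\<close> is increasing in \<open>N s\<close>, and
  \<open>N s \<le> 2 M\<close>.\<close>

lemma bohr_term_le:
  assumes bound: "real (n + 2) * real (n + 1) * (cmod (a (n + 2)) + cmod (b (n + 2))) \<le> 2 * M"
    and r: "0 \<le> r" and M: "M > 0"
  shows "bohr_term a b r (n + 2) \<le> 2 * M * (2 * M + 1) * (r ^ (n + 2) / (real (n + 2) * real (n + 1)))"
proof -
  define N where "N = real (n + 2) * real (n + 1)"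
  define s where "s = cmod (a (n + 2)) + cmod (b (n + 2))"
  have N: "N > 0" and s: "s \<ge> 0" and Ns: "N * s \<le> 2 * M"
    using bound by (simp_all add: N_def s_def)
  have "N * (s + N * s\<^sup>2) = (N * s) * (N * s + 1)"
    by (simp add: algebra_simps power2_eq_square)
  also have "\<dots> \<le> 2 * M * (2 * M + 1)"
    using mult_mono[of "N * s" "2 * M" "N * s + 1" "2 * M + 1"] Ns N s M by simp
  finally have "s + N * s\<^sup>2 \<le> 2 * M * (2 * M + 1) / N"
    using N by (simp add: field_simps)
  then have "(s + N * s\<^sup>2) * r ^ (n + 2) \<le> 2 * M * (2 * M + 1) / N * r ^ (n + 2)"
    using r by (intro mult_right_mono) auto
  moreover have "bohr_term a b r (n + 2) = (s + N * s\<^sup>2) * r ^ (n + 2)"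
    by (simp add: bohr_term_def s_def N_def)
  ultimately show ?thesis
    by (simp add: N_def)
qed

lemma bohr_term_nonneg: "0 \<le> r \<Longrightarrow> 0 \<le> bohr_term a b r (n + 2)"
  by (simp add: bohr_term_def)

lemma bohr_sum_le:
  assumes f: "f \<in> PH0 M" and exp: "harmonic_expansion f a b" and M: "M > 0" and r: "0 \<le> r" "r < 1"
  shows "summable (\<lambda>n. bohr_term a b r (n + 2))"
    and "(\<Sum>n. bohr_term a b r (n + 2)) \<le> 2 * M * (2 * M + 1) * (r + (1 - r) * ln (1 - r))"
proof -
  have le: "bohr_term a b r (n + 2) \<le> 2 * M * (2 * M + 1) * (r ^ (n + 2) / (real (n + 2) * real (n + 1)))" for n
    using PH0_coefficient_bound[OF f exp] r(1) M by (rule bohr_term_le)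
  note maj = sums_bohr_majorant[OF r, of "2 * M * (2 * M + 1)"]
  show summ: "summable (\<lambda>n. bohr_term a b r (n + 2))"
    by (rule summable_comparison_test'[OF sums_summable[OF maj], of 0])
      (use le bohr_term_nonneg[OF r(1)] in \<open>simp only: real_norm_def abs_of_nonneg\<close>)
  show "(\<Sum>n. bohr_term a b r (n + 2)) \<le> 2 * M * (2 * M + 1) * (r + (1 - r) * ln (1 - r))"
    using suminf_le[OF le summ sums_summable[OF maj]] sums_unique[OF maj] by simp
qed

section \<open>The extremal function\<close>

text \<open>Here \<open>M + z f'' = M (1 - z) / (1 + z)\<close>, the half-plane map that attains
  equality in Caratheodory's inequality and, on the positive radius, in Harnack's.\<close>

definition bohr_extremal :: "real \<Rightarrow> complex \<Rightarrow> complex" where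
  "bohr_extremal M z = z - 2 * of_real M * ((1 + z) * Ln (1 + z) - z)"

text \<open>The zero denominator makes the values at \<open>0\<close> and \<open>1\<close> equal to
  \<open>0\<close>; the linear term of the expansion is written separately.\<close>

definition bohr_extremal_coeff :: "real \<Rightarrow> nat \<Rightarrow> complex" where
  "bohr_extremal_coeff M n = - 2 * of_real M * (-1) ^ n / (of_nat n * of_nat (n - 1))"

lemma bohr_extremal_derivs:
  assumes "norm z < 1"
  shows "(bohr_extremal M has_field_derivative 1 - 2 * of_real M * Ln (1 + z)) (at z)"
    and "deriv (deriv (bohr_extremal M)) z = - 2 * of_real M / (1 + z)"
proof -
  \<comment> \<open>\<open>1 + z\<close> has positive real part, so it avoids the branch cut of
    \<open>Ln\<close>.\<close>
  have nr: "1 + z \<notin> \<real>\<^sub>\<le>\<^sub>0" "1 + z \<noteq> 0" if "norm z < 1" for z :: complex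
  proof -
    have "- 1 < Re z"
      using abs_Re_le_cmod[of z] that by linarith
    then show "1 + z \<notin> \<real>\<^sub>\<le>\<^sub>0" "1 + z \<noteq> 0"
      by (auto simp: complex_nonpos_Reals_iff complex_eq_iff)
  qed
  have d: "(bohr_extremal M has_field_derivative 1 - 2 * of_real M * Ln (1 + z)) (at z)" if "norm z < 1" for z
    unfolding bohr_extremal_def using nr[OF that] by (auto intro!: derivative_eq_intros)
  then show "(bohr_extremal M has_field_derivative 1 - 2 * of_real M * Ln (1 + z)) (at z)"
    using assms .
  have "eventually (\<lambda>y. y \<in> ball (0 :: complex) 1) (nhds z)"
    using assms by (intro eventually_nhds_in_open) auto
  then have "eventually (\<lambda>y. deriv (bohr_extremal M) y = 1 - 2 * of_real M * Ln (1 + y)) (nhds z)"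
    by (rule eventually_mono) (simp add: DERIV_imp_deriv[OF d])
  then have "deriv (deriv (bohr_extremal M)) z = deriv (\<lambda>y. 1 - 2 * of_real M * Ln (1 + y)) z"
    by (intro deriv_cong_ev refl)
  also have "\<dots> = - 2 * of_real M / (1 + z)"
    using nr[OF assms] by (intro DERIV_imp_deriv) (auto intro!: derivative_eq_intros simp: field_simps)
  finally show "deriv (deriv (bohr_extremal M)) z = - 2 * of_real M / (1 + z)" .
qed

text \<open>Clearing the denominator \<open>|1 + z|^2\<close> leaves \<open>|z|^2 < 1\<close>. This
  is the inequality of the class for \<open>bohr_extremal\<close>, divided by
  \<open>- 2 M\<close>.\<close>

lemma Re_div_one_plus_less_half:
  assumes "norm z < 1"
  shows "Re (z / (1 + z)) < 1 / 2"
proof -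
  have "(norm z)\<^sup>2 < 1"
    using assms by (simp add: abs_square_less_1)
  then have *: "(Re z)\<^sup>2 + (Im z)\<^sup>2 < 1"
    by (simp add: cmod_power2)
  have "- 1 < Re z"
    using abs_Re_le_cmod[of z] assms by linarith
  then have "0 < (1 + Re z)\<^sup>2 + (Im z)\<^sup>2"
    by (intro add_pos_nonneg) auto
  then show ?thesis
    using * by (simp add: Re_divide field_simps power2_eq_square)
qed

lemma bohr_extremal_in_PH0:
  assumes M: "M > 0"
  shows "bohr_extremal M \<in> PH0 M"
  unfolding PH0_def
proof (intro CollectI exI conjI ballI)
  show "H0_decomposition (bohr_extremal M) (bohr_extremal M) (\<lambda>_. 0)"
  proof -
    have "bohr_extremal M holomorphic_on ball 0 1"
      unfolding holomorphic_on_open[OF open_ball] using bohr_extremal_derivs(1) by (meson mem_ball_0)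
    moreover have "deriv (bohr_extremal M) 0 = 1"
      using DERIV_imp_deriv[OF bohr_extremal_derivs(1)[of 0 M]] by simp
    ultimately show ?thesis
      by (simp add: H0_decomposition_def bohr_extremal_def[of M 0])
  qed
  fix z :: complex assume "z \<in> ball 0 1"
  then have z: "norm z < 1" by simp
  have "z * deriv (deriv (bohr_extremal M)) z = of_real (- 2 * M) * (z / (1 + z))"
    using bohr_extremal_derivs(2)[OF z] by simp
  then have "Re (z * deriv (deriv (bohr_extremal M)) z) = - 2 * M * Re (z / (1 + z))"
    by (simp only: scaleR_conv_of_real[symmetric] scaleR_complex.sel)
  then show "- M + cmod (z * deriv (deriv (\<lambda>_. 0)) z) < Re (z * deriv (deriv (bohr_extremal M)) z)"
    using Re_div_one_plus_less_half[OF z] M by simp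
qed

lemma bohr_extremal_expansion:
  "harmonic_expansion (bohr_extremal M) (bohr_extremal_coeff M) (\<lambda>_. 0)"
  unfolding harmonic_expansion_def
proof
  fix z :: complex assume "z \<in> ball 0 1"
  then have "norm z < 1" by simp
  from sums_mult[OF sums_one_plus_times_Ln[OF this], of "- 2 * of_real M"]
  have "(\<lambda>n. bohr_extremal_coeff M (n + 2) * z ^ (n + 2)) sums (- 2 * of_real M * ((1 + z) * Ln (1 + z) - z))"
    by (simp add: bohr_extremal_coeff_def mult.assoc)
  then show "summable (\<lambda>n. bohr_extremal_coeff M (n + 2) * z ^ (n + 2)) \<and> summable (\<lambda>n. 0 * z ^ (n + 2)) \<and>
    bohr_extremal M z = z + (\<Sum>n. bohr_extremal_coeff M (n + 2) * z ^ (n + 2)) + cnj (\<Sum>n. 0 * z ^ (n + 2))"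
    by (simp only: sums_iff) (simp add: bohr_extremal_def)
qed

text \<open>The moduli attain the coefficient bound for every \<open>n\<close>, so
  \<open>bohr_term_le\<close> becomes an equality.\<close>

lemma bohr_term_extremal:
  assumes M: "M > 0"
  shows "bohr_term (bohr_extremal_coeff M) (\<lambda>_. 0) r (n + 2)
    = 2 * M * (2 * M + 1) * (r ^ (n + 2) / (real (n + 2) * real (n + 1)))"
proof -
  define N where "N = real (n + 2) * real (n + 1)"
  have "N > 0" by (simp add: N_def)
  have "cmod (bohr_extremal_coeff M (n + 2)) = 2 * M / N"
    using M by (simp add: bohr_extremal_coeff_def N_def norm_mult norm_divide norm_power flip: of_nat_Suc)
  then have "bohr_term (bohr_extremal_coeff M) (\<lambda>_. 0) r (n + 2) = (2 * M / N + N * (2 * M / N)\<^sup>2) * r ^ (n + 2)"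
    by (simp add: bohr_term_def N_def)
  also have "2 * M / N + N * (2 * M / N)\<^sup>2 = 2 * M * (2 * M + 1) / N"
    using \<open>N > 0\<close> by (simp add: field_simps power2_eq_square)
  finally show ?thesis
    by (simp add: N_def)
qed

text \<open>On the positive radius the function is real and its modulus tends to the absolute value
  of the bound; the hypothesis removes that absolute value.\<close>

lemma boundary_dist_bohr_extremal_le:
  assumes "0 \<le> 1 + 2 * M * (1 - ln 4)"
  shows "boundary_dist (bohr_extremal M) \<le> ereal (1 + 2 * M * (1 - ln 4))"
proof (rule boundary_dist_le_radial_limit)
  define L where "L r = r - 2 * M * ((1 + r) * ln (1 + r) - r)" for r :: real
  have "((\<lambda>t. \<bar>L t\<bar>) \<longlongrightarrow> \<bar>1 + 2 * M * (1 - ln 4)\<bar>) (at_left 1)"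
    unfolding L_def by (intro tendsto_rabs radial_growth_limit)
  then have "((\<lambda>t. \<bar>L t\<bar>) \<longlongrightarrow> 1 + 2 * M * (1 - ln 4)) (at_left 1)"
    using assms by simp
  moreover have "eventually (\<lambda>t. \<bar>L t\<bar> = cmod (bohr_extremal M (of_real t) - bohr_extremal M 0)) (at_left 1)"
    using eventually_at_left_real[OF zero_less_one]
  proof eventually_elim
    fix t :: real assume t: "t \<in> {0<..<1}"
    have "Ln (1 + of_real t) = of_real (ln (1 + t))"
      using Ln_of_real[of "1 + t"] t by simp
    then have "bohr_extremal M (of_real t) - bohr_extremal M 0 = of_real (L t)"
      by (simp add: bohr_extremal_def L_def)
    then show "\<bar>L t\<bar> = cmod (bohr_extremal M (of_real t) - bohr_extremal M 0)"
      by (simp only: norm_of_real)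
  qed
  ultimately show "((\<lambda>t. cmod (bohr_extremal M (of_real t) - bohr_extremal M 0)) \<longlongrightarrow> 1 + 2 * M * (1 - ln 4)) (at_left 1)"
    by (rule Lim_transform_eventually)
qed

section \<open>Roots of the Bohr equation\<close>

definition bohr_majorant :: "real \<Rightarrow> real \<Rightarrow> real" where
  "bohr_majorant M r = r + 2 * M * (2 * M + 1) * (r + (1 - r) * ln (1 - r))"

lemma bohr_equation_iff: "bohr_equation M r \<longleftrightarrow> bohr_majorant M r = 1 + 2 * M * (1 - ln 4)"
  by (auto simp: bohr_equation_def bohr_majorant_def algebra_simps)

lemma bohr_majorant_strict_mono:
  assumes "M > 0" "0 \<le> r" "r < s" "s < 1"
  shows "bohr_majorant M r < bohr_majorant M s"
  unfolding bohr_majorant_def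
  using assms by (intro add_strict_mono mult_strict_left_mono strict_mono_one_minus_times_ln) auto

text \<open>The majorant rises strictly from \<open>0\<close> at \<open>0\<close> towards
  \<open>1 + 2 M (2 M + 1)\<close> at \<open>1\<close>, which exceeds \<open>C\<close> because
  \<open>ln 4 > 1\<close>. So a root exists exactly when \<open>C > 0\<close>, which is the
  condition on \<open>M\<close>.\<close>

lemma smallest_bohr_root_ex_iff:
  assumes M: "M > 0"
  shows "(\<exists>r. smallest_bohr_root M r) \<longleftrightarrow> M < 1 / (2 * (ln 4 - 1))"
proof -
  \<comment> \<open>From \<open>exp 1 \<le> 3 < 4\<close>.\<close>
  have ln4: "1 < ln (4 :: real)"
    using ln_less_cancel_iff[of "exp 1" 4] exp_le by (simp del: ln_less_cancel_iff)
  define C where "C = 1 + 2 * M * (1 - ln 4)"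
  have C: "0 < C \<longleftrightarrow> M < 1 / (2 * (ln 4 - 1))"
    using ln4 by (simp add: C_def field_simps)
  have "0 < C" if "smallest_bohr_root M r" for r
    using that bohr_majorant_strict_mono[OF M, of 0 r]
    by (simp add: smallest_bohr_root_def bohr_equation_iff C_def) (simp add: bohr_majorant_def)
  moreover have "\<exists>r. smallest_bohr_root M r" if "0 < C"
  proof -
    have "((\<lambda>r :: real. (1 - r) * ln (1 - r)) \<longlongrightarrow> 0) (at_left 1)"
      by real_asymp
    then have "(bohr_majorant M \<longlongrightarrow> 1 + 2 * M * (2 * M + 1) * (1 + 0)) (at_left 1)"
      unfolding bohr_majorant_def by (intro tendsto_intros)
    moreover have "C < 1 + 2 * M * (2 * M + 1) * (1 + 0)"
    proof -
      have "2 * M * (1 - ln 4) < 0" "0 < 2 * M * (2 * M + 1)"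
        using M ln4 by (auto simp: mult_pos_neg)
      then show ?thesis by (simp add: C_def)
    qed
    ultimately have "eventually (\<lambda>r. C < bohr_majorant M r) (at_left 1)"
      by (rule order_tendstoD(1))
    then have "eventually (\<lambda>r. C < bohr_majorant M r \<and> r \<in> {0<..<1}) (at_left 1)"
      using eventually_at_left_real[OF zero_less_one] by (rule eventually_conj)
    from eventually_happens'[OF trivial_limit_at_left_real this]
    obtain s where s: "C < bohr_majorant M s" "0 < s" "s < 1"
      by auto
    have "continuous_on {0..s} (bohr_majorant M)"
      unfolding bohr_majorant_def using s by (intro continuous_intros) auto
    moreover have B0: "bohr_majorant M 0 = 0"
      by (simp add: bohr_majorant_def)
    ultimately obtain r where r: "0 \<le> r" "r \<le> s" "bohr_majorant M r = C"
      using IVT'[of "bohr_majorant M" 0 C s] s \<open>0 < C\<close> by auto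
    then have "r \<noteq> 0" using B0 \<open>0 < C\<close> by auto
    \<comment> \<open>Strict monotonicity excludes a root below the one found by the intermediate
      value theorem.\<close>
    have "r \<le> t" if "0 < t" "bohr_equation M t" for t
    proof (rule ccontr)
      assume "\<not> r \<le> t"
      then have "bohr_majorant M t < bohr_majorant M r"
        using r s that by (intro bohr_majorant_strict_mono M) auto
      then show False
        using r that by (simp add: bohr_equation_iff C_def)
    qed
    then have "smallest_bohr_root M r"
      using r s \<open>r \<noteq> 0\<close> by (auto simp: smallest_bohr_root_def bohr_equation_iff C_def)
    then show ?thesis ..
  qed
  ultimately show ?thesis
    unfolding C[symmetric] by blast
qed

text \<open>The first conjunct tells for which \<open>M\<close> the claims about the root have
  content. Sharpness is failure at some \<open>r \<le> R\<close> in \<open>[0, 1)\<close>, since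
  \<open>R\<close> itself may be \<open>1\<close> or more.\<close>

theorem theorem3p7:
  fixes M :: real
  assumes "M > 0"
  shows "((\<exists>r\<^sub>M. smallest_bohr_root M r\<^sub>M) \<longleftrightarrow> M < 1 / (2 * (ln 4 - 1))) \<and>
    (\<forall>r\<^sub>M. smallest_bohr_root M r\<^sub>M \<longrightarrow>
      (\<forall>f a b. f \<in> PH0 M \<and> harmonic_expansion f a b \<longrightarrow>
         (\<forall>r. 0 \<le> r \<and> r \<le> r\<^sub>M \<longrightarrow>
            summable (\<lambda>n. bohr_term a b r (n + 2)) \<and>
            ereal (r + (\<Sum>n. bohr_term a b r (n + 2))) \<le> boundary_dist f)) \<and>
      (\<forall>R. r\<^sub>M < R \<longrightarrow>
         (\<exists>f a b r. f \<in> PH0 M \<and> harmonic_expansion f a b \<and> 0 \<le> r \<and> r \<le> R \<and> r < 1 \<and>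
            summable (\<lambda>n. bohr_term a b r (n + 2)) \<and>
            boundary_dist f < ereal (r + (\<Sum>n. bohr_term a b r (n + 2))))))"
proof (intro conjI allI impI)
  show "(\<exists>r\<^sub>M. smallest_bohr_root M r\<^sub>M) \<longleftrightarrow> M < 1 / (2 * (ln 4 - 1))"
    by (rule smallest_bohr_root_ex_iff[OF assms])
next
  fix \<rho> f a b r
  assume \<rho>: "smallest_bohr_root M \<rho>" and "f \<in> PH0 M \<and> harmonic_expansion f a b" and "0 \<le> r \<and> r \<le> \<rho>"
  then have f: "f \<in> PH0 M" "harmonic_expansion f a b" and r: "0 \<le> r" "r \<le> \<rho>" "r < 1" "\<rho> < 1"
    by (auto simp: smallest_bohr_root_def)
  note bs = bohr_sum_le[OF f assms r(1,3)]
  show "summable (\<lambda>n. bohr_term a b r (n + 2))"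
    by (rule bs(1))
  have "r + (\<Sum>n. bohr_term a b r (n + 2)) \<le> bohr_majorant M r"
    using bs(2) by (simp add: bohr_majorant_def)
  also have "\<dots> \<le> bohr_majorant M \<rho>"
    using bohr_majorant_strict_mono[OF assms, of r \<rho>] r by (cases "r = \<rho>") auto
  also have "\<dots> = 1 + 2 * M * (1 - ln 4)"
    using \<rho> by (simp add: smallest_bohr_root_def bohr_equation_iff)
  finally show "ereal (r + (\<Sum>n. bohr_term a b r (n + 2))) \<le> boundary_dist f"
    by (intro order_trans[OF _ boundary_dist_lower_bound[OF f(1) assms]]) simp
next
  fix \<rho> R assume \<rho>: "smallest_bohr_root M \<rho>" and R: "\<rho> < R"
  have \<rho>': "0 < \<rho>" "\<rho> < 1" "bohr_majorant M \<rho> = 1 + 2 * M * (1 - ln 4)"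
    using \<rho> by (auto simp: smallest_bohr_root_def bohr_equation_iff)
  \<comment> \<open>Any radius past the root and below \<open>1\<close> works, as the majorant
    already exceeds the boundary value there.\<close>
  obtain r where r: "\<rho> < r" "r < min R 1"
    using dense[of \<rho> "min R 1"] R \<rho>' by auto
  have sums: "(\<lambda>n. bohr_term (bohr_extremal_coeff M) (\<lambda>_. 0) r (n + 2)) sums
      (2 * M * (2 * M + 1) * (r + (1 - r) * ln (1 - r)))"
    unfolding bohr_term_extremal[OF assms] using r \<rho>' by (intro sums_bohr_majorant) auto
  have less: "bohr_majorant M \<rho> < bohr_majorant M r"
    using r \<rho>' by (intro bohr_majorant_strict_mono assms) auto
  \<comment> \<open>The existence of a positive root forces the boundary value to be positive, as
    the bound for the extremal function requires.\<close>
  have "bohr_majorant M 0 < bohr_majorant M \<rho>"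
    using \<rho>' by (intro bohr_majorant_strict_mono assms) auto
  then have "0 \<le> 1 + 2 * M * (1 - ln 4)"
    unfolding \<rho>'(3) by (simp add: bohr_majorant_def)
  then have "boundary_dist (bohr_extremal M) \<le> ereal (bohr_majorant M \<rho>)"
    unfolding \<rho>'(3) by (rule boundary_dist_bohr_extremal_le)
  also have "\<dots> < ereal (r + (\<Sum>n. bohr_term (bohr_extremal_coeff M) (\<lambda>_. 0) r (n + 2)))"
    using less sums_unique[OF sums] by (simp add: bohr_majorant_def)
  finally show "\<exists>f a b r. f \<in> PH0 M \<and> harmonic_expansion f a b \<and> 0 \<le> r \<and> r \<le> R \<and> r < 1 \<and>
      summable (\<lambda>n. bohr_term a b r (n + 2)) \<and>
      boundary_dist f < ereal (r + (\<Sum>n. bohr_term a b r (n + 2)))"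
    using bohr_extremal_in_PH0[OF assms] bohr_extremal_expansion[of M] sums_summable[OF sums] r \<rho>'
    by (intro exI[of _ "bohr_extremal M"] exI[of _ "bohr_extremal_coeff M"] exI[of _ "\<lambda>_. 0"] exI[of _ r]) auto
qed

end
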